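(* Let $n\geq 1$ be an integer. The number of elements $(a,b,c,d)\in\mathbb N^4$ such that $n=ab-cd$ and $\min(a,b)>\max(c,d)$ is given by $$\sum_{d\mid n,\ d^2\geq n}\left(d+1-\frac{n}{d}\right),$$ where the sum runs over all positive divisors $d$ of $n$ with $d^2\geq n$. Moreover, the map $$(a,b,c,d)\longmapsto \begin{pmatrix} a & c\\ d & b\end{pmatrix}$$ is a one-to-one correspondence between such solutions $(a,b,c,d)$ and elements of the set $\mathcal R(n)$ of Euclid-reduced matrices having determinant $n$.
   Context: $\mathbb N=\{0,1,2,\ldots\}$ denotes the set of all non-negative integers. $\mathcal P$ denotes the set of all $2\times 2$ matrices with entries in $\mathbb N$ and strictly positive determinant. An elementary reduction of a $2\times 2$ matrix $M$ is a matrix in $\{EM,E^tM,ME,ME^t\}$, where $E=\begin{pmatrix}1&-1\\0&1\end{pmatrix}$ and $E^t$ is its transpose (that is, elementary reductions subtract a row, respectively column, of $M$ from the other row, respectively column). A matrix $M\in\mathcal P$ is Euclid-reduced if and only if $\mathcal P$ contains no elementary reduction of $M$. Equivalently, $M=\begin{pmatrix}\alpha&\beta\\\gamma&\delta\end{pmatrix}\in\mathcal P$ is Euclid-reduced if $\min(\alpha,\delta)>\max(\beta,\gamma)$. $\mathcal R(n)$ denotes the set of all Euclid-reduced matrices in $\mathcal P$ of determinant $n$. *)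

theory Defs
  imports "HOL-Analysis.Determinants"
begin

text \<open>Matrices have integer entries, since elementary reductions may leave the set of
  non-negative matrices; the natural entries are expressed by non-negativity.\<close>

definition mat22 :: "int \<Rightarrow> int \<Rightarrow> int \<Rightarrow> int \<Rightarrow> int^2^2" where
  "mat22 p q r s = vector [vector [p, q], vector [r, s]]"

definition nonneg_posdet :: "(int^2^2) set" where
  "nonneg_posdet = {M. (\<forall>i j. M $ i $ j \<ge> 0) \<and> det M > 0}"

definition elem_E :: "int^2^2" where
  "elem_E = mat22 1 (-1) 0 1"

definition elementary_reductions :: "int^2^2 \<Rightarrow> (int^2^2) set" where
  "elementary_reductions M =
     {elem_E ** M, transpose elem_E ** M, M ** elem_E, M ** transpose elem_E}"

definition Euclid_reduced :: "int^2^2 \<Rightarrow> bool" where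
  "Euclid_reduced M \<longleftrightarrow> M \<in> nonneg_posdet \<and> elementary_reductions M \<inter> nonneg_posdet = {}"

definition Euclid_reduced_det :: "nat \<Rightarrow> (int^2^2) set" where
  "Euclid_reduced_det n = {M. Euclid_reduced M \<and> det M = int n}"

definition solutions :: "nat \<Rightarrow> (nat \<times> nat \<times> nat \<times> nat) set" where
  "solutions n = {(a, b, c, d).
     int n = int a * int b - int c * int d \<and> min a b > max c d}"

end

theory Submission
  imports Defs
begin

text \<open>Read a solution as a pair of vectors \<open>u = (a, c)\<close>, \<open>v = (d, b)\<close> of determinant \<open>n\<close> that lie
  strictly on either side of the diagonal. The heights \<open>a - c\<close> and \<open>b - d\<close> below and above the
  diagonal are the data of a subtractive Euclidean algorithm: replace the vector of larger height
  by \<open>u + v\<close>. A pair has no successor iff its heights agree, and no predecessor iff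
  \<open>min a b > max c d\<close>. The step being a bijection from the pairs with a successor onto those with
  a predecessor, and there being finitely many pairs, the two kinds of terminal pairs are
  equinumerous. If the heights are both \<open>m\<close>, then \<open>n = m k\<close> with \<open>k = a + d = b + c\<close>, and \<open>c\<close>
  ranges freely over \<open>{0..k - m}\<close>.\<close>

text \<open>The determinant equation is put in sum form because subtraction of naturals
  truncates.\<close>

definition straddling :: "nat \<Rightarrow> (nat \<times> nat \<times> nat \<times> nat) set" where
  "straddling n = {(a, b, c, d). a * b = n + c * d \<and> c < a \<and> d < b}"

definition balanced :: "nat \<Rightarrow> (nat \<times> nat \<times> nat \<times> nat) set" where
  "balanced n = {(a, b, c, d) \<in> straddling n. a + d = b + c}"

text \<open>The test \<open>a + d > b + c\<close> compares the heights \<open>a - c\<close> and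
  \<open>b - d\<close> without subtracting.\<close>

definition euclid_step :: "nat \<times> nat \<times> nat \<times> nat \<Rightarrow> nat \<times> nat \<times> nat \<times> nat" where
  "euclid_step = (\<lambda>(a, b, c, d).
     if a + d > b + c then (a + d, b, c + b, d) else (a, b + c, c, d + a))"

definition euclid_unstep :: "nat \<times> nat \<times> nat \<times> nat \<Rightarrow> nat \<times> nat \<times> nat \<times> nat" where
  "euclid_unstep = (\<lambda>(a, b, c, d).
     if c \<ge> b then (a - d, b, c - b, d) else (a, b - c, c, d - a))"

lemma solutions_eq: "solutions n = {(a, b, c, d) \<in> straddling n. c < b \<and> d < a}"
proof -
  have "int n = int a * int b - int c * int d \<longleftrightarrow> a * b = n + c * d" for a b c d
    by (simp flip: of_nat_mult of_nat_add add: algebra_simps) linarith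
  then show ?thesis
    by (auto simp: solutions_def straddling_def)
qed

text \<open>\<open>n = a * b - c * d \<ge> (c + 1) * b - c * b = b\<close>.\<close>

lemma straddling_le:
  assumes "(a, b, c, d) \<in> straddling n"
  shows "b \<le> n"
proof -
  have eq: "a * b = n + c * d" and "c < a" "d < b"
    using assms by (auto simp: straddling_def)
  have "Suc c * b \<le> a * b" "c * d \<le> c * b"
    using \<open>c < a\<close> \<open>d < b\<close> by (simp_all only: mult_le_mono Suc_le_eq order_refl less_imp_le)
  then show ?thesis
    using eq unfolding mult_Suc by linarith
qed

lemma finite_straddling: "finite (straddling n)"
proof (rule finite_subset)
  have "a \<le> n \<and> b \<le> n \<and> c \<le> n \<and> d \<le> n" if x: "(a, b, c, d) \<in> straddling n" for a b c d
  proof -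
    \<comment> \<open>Reflection in the diagonal swaps the two vectors, so the bound on
      \<open>b\<close> also bounds \<open>a\<close>.\<close>
    have "(b, a, d, c) \<in> straddling n"
      using x by (auto simp: straddling_def mult.commute)
    then have "a \<le> n" "b \<le> n"
      using x straddling_le by blast+
    with x show ?thesis
      by (auto simp: straddling_def)
  qed
  then show "straddling n \<subseteq> {..n} \<times> {..n} \<times> {..n} \<times> {..n}"
    by auto
qed simp

text \<open>The result reveals which branch produced it: adding v to u forces
  \<open>c \<ge> b\<close>, adding u to v forces \<open>d \<ge> a\<close>. Both at once would give
  \<open>a > c \<ge> b > d \<ge> a\<close>.\<close>

lemma bij_betw_euclid_step:
  "bij_betw euclid_step (straddling n - balanced n) (straddling n - solutions n)"
proof (rule bij_betw_byWitness[where f' = euclid_unstep])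
  show "\<forall>x \<in> straddling n - balanced n. euclid_unstep (euclid_step x) = x"
    by (auto simp: euclid_step_def euclid_unstep_def straddling_def balanced_def split: if_splits)
  show "\<forall>x \<in> straddling n - solutions n. euclid_step (euclid_unstep x) = x"
    by (auto simp: euclid_step_def euclid_unstep_def straddling_def solutions_eq split: if_splits)
  show "euclid_step ` (straddling n - balanced n) \<subseteq> straddling n - solutions n"
    by (auto simp: euclid_step_def straddling_def balanced_def solutions_eq algebra_simps split: if_splits)
  \<comment> \<open>The heights of this predecessor differ by \<open>a - c > 0\<close>, so it is not
    balanced. Substituting \<open>c = b + e\<close> and \<open>a = d + f\<close> removes the
    truncated subtractions.\<close>
  have "(a - d, b, c - b, d) \<in> straddling n - balanced n"
    if x: "(a, b, c, d) \<in> straddling n" and "b \<le> c" for a b c d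
  proof -
    obtain e where e: "c = b + e"
      using \<open>b \<le> c\<close> le_Suc_ex by blast
    have "d \<le> a"
      using x \<open>b \<le> c\<close> by (auto simp: straddling_def)
    then obtain f where f: "a = d + f"
      using le_Suc_ex by blast
    show ?thesis
      using x by (auto simp: e f straddling_def balanced_def algebra_simps)
  qed
  moreover have "(a, b - c, c, d - a) \<in> straddling n - balanced n"
    if x: "(a, b, c, d) \<in> straddling n" and "a \<le> d" for a b c d
  proof -
    obtain e where e: "d = a + e"
      using \<open>a \<le> d\<close> le_Suc_ex by blast
    have "c \<le> b"
      using x \<open>a \<le> d\<close> by (auto simp: straddling_def)
    then obtain f where f: "b = c + f"
      using le_Suc_ex by blast
    show ?thesis
      using x by (auto simp: e f straddling_def balanced_def algebra_simps)
  qed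
  ultimately show "euclid_unstep ` (straddling n - solutions n) \<subseteq> straddling n - balanced n"
    by (force simp: euclid_unstep_def solutions_eq)
qed

lemma card_solutions_eq_card_balanced: "card (solutions n) = card (balanced n)"
proof -
  have sub: "solutions n \<subseteq> straddling n" "balanced n \<subseteq> straddling n"
    by (auto simp: solutions_eq balanced_def)
  then have fin: "finite (solutions n)" "finite (balanced n)"
    using finite_straddling finite_subset by blast+
  have "card (straddling n - balanced n) = card (straddling n - solutions n)"
    by (rule bij_betw_same_card[OF bij_betw_euclid_step])
  \<comment> \<open>These bounds allow cancellation in the truncated differences of
    cardinalities.\<close>
  moreover have "card (solutions n) \<le> card (straddling n)" "card (balanced n) \<le> card (straddling n)"
    using sub finite_straddling by (auto intro: card_mono)
  ultimately show ?thesis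
    using sub fin by (simp add: card_Diff_subset)
qed

text \<open>With common height \<open>m = n div k\<close>, the determinant is
  \<open>(c + m) * (d + m) - c * d = m * (c + d + m) = m * k\<close>. Since
  \<open>d = k - m - c\<close> must be non-negative, \<open>m \<le> k\<close> is required, that is
  \<open>n \<le> k\<^sup>2\<close>.\<close>

lemma bij_betw_balanced:
  assumes "n \<ge> 1"
  shows "bij_betw (\<lambda>(k, c). (c + n div k, k - c, c, k - n div k - c))
    (SIGMA k:{k. k dvd n \<and> k\<^sup>2 \<ge> n}. {0..k - n div k}) (balanced n)"
    (is "bij_betw ?f ?S _")
proof (rule bij_betw_byWitness[where f' = "\<lambda>(a, b, c, d). (a + d, c)"])
  have le: "n div k \<le> k" if "n \<le> k\<^sup>2" for k
    using div_le_mono[OF that, of k] by (cases "k = 0") (simp_all add: power2_eq_square)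
  show "\<forall>x \<in> ?S. (\<lambda>(a, b, c, d). (a + d, c)) (?f x) = x"
    using le by fastforce
  have bal: "\<exists>m. 0 < m \<and> a = c + m \<and> b = d + m \<and> n = (a + d) * m"
    if x: "(a, b, c, d) \<in> balanced n" for a b c d
  proof -
    obtain m where m: "a = c + m"
      using x le_Suc_ex[of c a] by (auto simp: balanced_def straddling_def)
    with x show ?thesis
      by (intro exI[of _ m]) (auto simp: balanced_def straddling_def algebra_simps)
  qed
  show "\<forall>x \<in> balanced n. ?f ((\<lambda>(a, b, c, d). (a + d, c)) x) = x"
    by (auto dest!: bal)
  show "(\<lambda>(a, b, c, d). (a + d, c)) ` balanced n \<subseteq> ?S"
    by (auto dest!: bal simp: power2_eq_square)
  have "(c + n div k, k - c, c, k - n div k - c) \<in> balanced n"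
    if k: "k dvd n" "n \<le> k\<^sup>2" and c: "c \<le> k - n div k" for k c
  proof -
    define m where "m = n div k"
    define d where "d = k - m - c"
    have n: "n = k * m" and "0 < m"
      using k assms by (auto simp: m_def dvd_def)
    have "k = c + m + d"
      using le[OF k(2)] c by (simp add: m_def d_def)
    then show ?thesis
      using n \<open>0 < m\<close> unfolding m_def[symmetric]
      by (auto simp: balanced_def straddling_def algebra_simps)
  qed
  then show "?f ` ?S \<subseteq> balanced n"
    by auto
qed

lemma card_balanced:
  assumes "n \<ge> 1"
  shows "int (card (balanced n)) =
    (\<Sum>d | d dvd n \<and> d\<^sup>2 \<ge> n. int d + 1 - int n div int d)"
proof -
  \<comment> \<open>The fibre over a divisor is an interval starting at 0, hence the
    \<open>Suc\<close>.\<close>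
  have "card (balanced n) = (\<Sum>d | d dvd n \<and> d\<^sup>2 \<ge> n. Suc (d - n div d))"
    using bij_betw_same_card[OF bij_betw_balanced[OF assms]] assms by simp
  also have "int \<dots> = (\<Sum>d | d dvd n \<and> d\<^sup>2 \<ge> n. int d + 1 - int n div int d)"
    unfolding of_nat_sum
  proof (rule sum.cong[OF refl])
    fix d
    assume "d \<in> {d. d dvd n \<and> d\<^sup>2 \<ge> n}"
    then have "n div d \<le> d"
      using div_le_mono[of n "d\<^sup>2" d] by (cases "d = 0") (simp_all add: power2_eq_square)
    then show "int (Suc (d - n div d)) = int d + 1 - int n div int d"
      by (simp add: of_nat_diff zdiv_int)
  qed
  finally show ?thesis .
qed

lemma mat22_nth [simp]:
  "mat22 p q r s $ 1 $ 1 = p" "mat22 p q r s $ 1 $ 2 = q"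
  "mat22 p q r s $ 2 $ 1 = r" "mat22 p q r s $ 2 $ 2 = s"
  by (simp_all add: mat22_def)

lemma mat22_eta: "mat22 (M $ 1 $ 1) (M $ 1 $ 2) (M $ 2 $ 1) (M $ 2 $ 2) = M"
  by (simp add: vec_eq_iff forall_2)

lemma mat22_eq_iff [simp]:
  "mat22 p q r s = mat22 p' q' r' s' \<longleftrightarrow> p = p' \<and> q = q' \<and> r = r' \<and> s = s'"
  by (auto simp: vec_eq_iff forall_2)

lemma det_mat22 [simp]: "det (mat22 p q r s) = p * s - q * r"
  by (simp add: det_2)

lemma mat22_in_nonneg_posdet:
  "mat22 p q r s \<in> nonneg_posdet \<longleftrightarrow> 0 \<le> p \<and> 0 \<le> q \<and> 0 \<le> r \<and> 0 \<le> s \<and> q * r < p * s"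
  by (auto simp: nonneg_posdet_def forall_2)

lemma elementary_reductions_mat22:
  "elementary_reductions (mat22 p q r s) =
     {mat22 (p - r) (q - s) r s, mat22 p q (r - p) (s - q),
      mat22 p (q - p) r (s - r), mat22 (p - q) q (r - s) s}"
proof -
  have "elem_E ** mat22 p q r s = mat22 (p - r) (q - s) r s"
    "transpose elem_E ** mat22 p q r s = mat22 p q (r - p) (s - q)"
    "mat22 p q r s ** elem_E = mat22 p (q - p) r (s - r)"
    "mat22 p q r s ** transpose elem_E = mat22 (p - q) q (r - s) s"
    by (simp_all add: vec_eq_iff forall_2 matrix_matrix_mult_def sum_2 transpose_def elem_E_def)
  then show ?thesis
    by (simp add: elementary_reductions_def)
qed

text \<open>Elementary reductions keep the determinant, so one leaves \<open>nonneg_posdet\<close>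
  only by acquiring a negative entry.\<close>

lemma Euclid_reduced_mat22:
  "Euclid_reduced (mat22 p q r s) \<longleftrightarrow> 0 \<le> q \<and> 0 \<le> r \<and> max q r < min p s"
proof
  assume red: "Euclid_reduced (mat22 p q r s)"
  then have nonneg: "0 \<le> p" "0 \<le> q" "0 \<le> r" "0 \<le> s" and det: "q * r < p * s"
    by (auto simp: Euclid_reduced_def mat22_in_nonneg_posdet)
  have "\<not> (r \<le> p \<and> s \<le> q)" "\<not> (p \<le> r \<and> q \<le> s)" "\<not> (p \<le> q \<and> r \<le> s)" "\<not> (q \<le> p \<and> s \<le> r)"
    using red nonneg det
    by (auto simp: Euclid_reduced_def elementary_reductions_mat22 mat22_in_nonneg_posdet
        algebra_simps)
  \<comment> \<open>Either case would give \<open>p * s \<le> q * r\<close>. With these two, the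
    four disjunctions above leave only the strict inequalities claimed.\<close>
  moreover have "\<not> (p \<le> r \<and> s \<le> q)" "\<not> (p \<le> q \<and> s \<le> r)"
    using mult_mono[of p r s q] mult_mono[of p q s r] nonneg det by (auto simp: mult.commute)
  ultimately show "0 \<le> q \<and> 0 \<le> r \<and> max q r < min p s"
    using nonneg by linarith
next
  assume *: "0 \<le> q \<and> 0 \<le> r \<and> max q r < min p s"
  then have "q * r < p * s"
    by (intro mult_strict_mono) auto
  \<comment> \<open>The four reductions contain the negative entries \<open>q - s\<close>,
    \<open>r - p\<close>, \<open>q - p\<close> and \<open>r - s\<close> respectively.\<close>
  with * show "Euclid_reduced (mat22 p q r s)"
    by (auto simp: Euclid_reduced_def elementary_reductions_mat22 mat22_in_nonneg_posdet)
qed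

lemma bij_betw_solutions_Euclid_reduced_det:
  "bij_betw (\<lambda>(a, b, c, d). mat22 (int a) (int c) (int d) (int b))
     (solutions n) (Euclid_reduced_det n)"
proof (rule bij_betw_imageI)
  show "inj_on (\<lambda>(a, b, c, d). mat22 (int a) (int c) (int d) (int b)) (solutions n)"
    by (auto simp: inj_on_def)
  show "(\<lambda>(a, b, c, d). mat22 (int a) (int c) (int d) (int b)) ` solutions n =
    Euclid_reduced_det n"
  proof
    show "(\<lambda>(a, b, c, d). mat22 (int a) (int c) (int d) (int b)) ` solutions n
      \<subseteq> Euclid_reduced_det n"
      by (auto simp: solutions_def Euclid_reduced_det_def Euclid_reduced_mat22)
    show "Euclid_reduced_det n
      \<subseteq> (\<lambda>(a, b, c, d). mat22 (int a) (int c) (int d) (int b)) ` solutions n"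
    proof
      fix M
      assume M: "M \<in> Euclid_reduced_det n"
      obtain p q r s where M_eq: "M = mat22 p q r s"
        using mat22_eta by metis
      have "0 \<le> q" "0 \<le> r" "max q r < min p s" "p * s - q * r = int n"
        using M by (auto simp: M_eq Euclid_reduced_det_def Euclid_reduced_mat22)
      then show "M \<in> (\<lambda>(a, b, c, d). mat22 (int a) (int c) (int d) (int b)) ` solutions n"
        \<comment> \<open>The diagonal entries come first, matching the order (a, b, c, d);
          \<open>nat\<close> loses nothing as all entries are non-negative.\<close>
        by (intro image_eqI[of _ _ "(nat p, nat s, nat q, nat r)"])
          (auto simp: M_eq solutions_def)
    qed
  qed
qed

theorem theorem1p1:
  fixes n :: nat
  assumes "n \<ge> 1"
  shows "finite (solutions n) \<and>
         int (card (solutions n)) =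
           (\<Sum>d | d dvd n \<and> d\<^sup>2 \<ge> n. int d + 1 - int n div int d) \<and>
         bij_betw (\<lambda>(a, b, c, d). mat22 (int a) (int c) (int d) (int b))
           (solutions n) (Euclid_reduced_det n)"
proof (intro conjI)
  show "finite (solutions n)"
    by (rule finite_subset[OF _ finite_straddling]) (auto simp: solutions_eq)
  show "int (card (solutions n)) =
      (\<Sum>d | d dvd n \<and> d\<^sup>2 \<ge> n. int d + 1 - int n div int d)"
    using card_balanced[OF assms] by (simp add: card_solutions_eq_card_balanced)
qed (rule bij_betw_solutions_Euclid_reduced_det)

end
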